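(* The 10-dimensional Cohn-Elkies linear programming bound (i.e., the Cohn-Elkies linear programming bound in $\mathbb{R}^{10}$) is greater than or equal to $\frac{1}{24}>0.04166666$.
   Context: Fourier transform on $\mathbb{R}^d$: $\widehat f(y)=\int_{\mathbb{R}^d} f(x)e^{-2\pi i\langle x,y\rangle}\,dx$, where $\langle x,y\rangle=x_1y_1+\cdots+x_dy_d$. A function $f:\mathbb{R}^d\to\mathbb{R}$ is rapidly decreasing if $f(x)=O\left((1+|x|)^{-k}\right)$ for all positive integers $k$; it is radial if $f(x)$ depends only on $|x|$. For fixed $r>0$ and positive integer $d$, the Cohn-Elkies linear programming bound in $\mathbb{R}^d$ is the infimum of $\left(\frac r2\right)^d f(0)$ over all radial, smooth, rapidly decreasing functions $f:\mathbb{R}^d\to\mathbb{R}$ such that $f(0)>0$; $\widehat f(0)\geq 1$; $f(x)\leq 0$ for all $|x|\geq r$; and $\widehat f(y)\geq 0$ for all $y\in\mathbb{R}^d$. This value does not depend on $r$ (by rescaling $f$). *)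

theory Defs
  imports "HOL-Analysis.Analysis" "HOL-Library.Landau_Symbols" "HOL-Library.Complex_Order"
begin

definition fourier :: "('a::euclidean_space \<Rightarrow> real) \<Rightarrow> 'a \<Rightarrow> complex" where
  "fourier f y = (\<integral>x. complex_of_real (f x) * exp (- 2 * pi * \<i> * complex_of_real (x \<bullet> y)) \<partial>lborel)"

(* Continuous derivatives up to order k, via iterated directional derivatives. *)
primrec times_cont_diff :: "nat \<Rightarrow> ('a::euclidean_space \<Rightarrow> real) \<Rightarrow> bool" where
  "times_cont_diff 0 f \<longleftrightarrow> continuous_on UNIV f"
| "times_cont_diff (Suc k) f \<longleftrightarrow>
     (\<forall>x. f differentiable (at x)) \<and>
     (\<forall>v. times_cont_diff k (\<lambda>x. frechet_derivative f (at x) v))"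

definition smooth :: "('a::euclidean_space \<Rightarrow> real) \<Rightarrow> bool" where
  "smooth f \<longleftrightarrow> (\<forall>k. times_cont_diff k f)"

(* For continuous f, the bound at infinity is the same as a bound on the whole space. *)
definition rapidly_decreasing :: "('a::euclidean_space \<Rightarrow> real) \<Rightarrow> bool" where
  "rapidly_decreasing f \<longleftrightarrow> (\<forall>k>0::nat. f \<in> O[at_infinity](\<lambda>x. 1 / (1 + norm x) ^ k))"

definition radial :: "('a::euclidean_space \<Rightarrow> real) \<Rightarrow> bool" where
  "radial f \<longleftrightarrow> (\<forall>x y. norm x = norm y \<longrightarrow> f x = f y)"

(* The inequalities on the complex numbers fourier f 0 and fourier f y are those of
   HOL-Library.Complex_Order; they include that these numbers are real. *)
definition cohn_elkies_admissible :: "real \<Rightarrow> ('a::euclidean_space \<Rightarrow> real) \<Rightarrow> bool" where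
  "cohn_elkies_admissible r f \<longleftrightarrow>
     radial f \<and> smooth f \<and> rapidly_decreasing f \<and>
     f 0 > 0 \<and> fourier f 0 \<ge> 1 \<and>
     (\<forall>x. norm x \<ge> r \<longrightarrow> f x \<le> 0) \<and>
     (\<forall>y. fourier f y \<ge> 0)"

(* The space is given by its type. The infimum is taken in ereal, so that it is a genuine
   infimum with no side condition on the set. *)
definition cohn_elkies_bound :: "'a::euclidean_space itself \<Rightarrow> real \<Rightarrow> ereal" where
  "cohn_elkies_bound _ r =
     (INF f \<in> {f :: 'a \<Rightarrow> real. cohn_elkies_admissible r f}. ereal ((r / 2) ^ DIM('a) * f 0))"

end

theory Submission
  imports Defs
begin

text \<open>
  The bound is proved by linear programming duality. After rescaling, let \<open>f\<close> be admissible for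
  radius 2 and put \<open>n = 10\<close>. Give each integer point \<open>x\<close> the weight \<open>h C\<close>, where \<open>C\<close> is the set of its odd
  coordinates. Suppose that \<open>h\<close> is nonnegative with \<open>h {} = 1\<close>, that it vanishes on the nonempty sets
  with fewer than four elements, and that its Fourier transform on the group of subsets is nonnegative.
  Formally, Poisson summation over the integer lattice and the half-integer lattice gives
  \<open>f 0 \<ge> (\<Sum>x. h x * f x) = 2 ^ (- n) * (\<Sum>y. H y * F y) \<ge> 2 ^ (- n) * H 0 * F 0\<close>
  where \<open>F\<close> is the transform of \<open>f\<close> and \<open>H y\<close> the transform of \<open>h\<close> at the set of odd coordinates of
  \<open>2 * y\<close>: all points of nonzero weight other than the origin have norm at least 2, where \<open>f \<le> 0\<close>, and
  all terms on the right are nonnegative. So any feasible point of Delsarte's linear program for binary codes of length \<open>n\<close> and distance 4 gives a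
  lower bound. The weights \<open>delsarte\<close> have total mass \<open>H 0 = 128 / 3\<close>, and \<open>128 / 3 / 2 ^ 10 = 1 / 24\<close>.

  The inequality between the two ends of this chain is obtained as a limit of inequalities between
  absolutely convergent integrals. The sum of point masses is replaced by a trigonometric polynomial,
  the \<open>comb\<close>, whose building blocks are products of the kernels \<open>cos ^ (2 * N)\<close> and \<open>sin ^ (2 * N)\<close> in the coordinates. Its Fourier
  coefficients are nonnegative, so its integral against \<open>f\<close> is at least the term of frequency 0
  (\<open>comb_integral_ge\<close>). As \<open>N\<close> grows, the kernels concentrate at the integer points, so the integral of
  the positive part of \<open>f\<close> against the comb is asymptotically at most the contribution of the origin
  (\<open>spike_concentration\<close>). The result of both estimates is \<open>lattice_dual_bound\<close>.
\<close>

section \<open>Powers of sine and cosine as kernels on the line\<close>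

definition wave :: "bool \<Rightarrow> real \<Rightarrow> real" where
  "wave p t = (if p then sin (pi * t / 2) else cos (pi * t / 2))"

text \<open>This is the mean value of \<open>cos ^ (2 * N)\<close> and of \<open>sin ^ (2 * N)\<close>, and also the constant Fourier
  coefficient of \<open>wave p ^ (2 * N)\<close>.\<close>
definition wallis :: "nat \<Rightarrow> real" where
  "wallis N = real ((2 * N) choose N) / 4 ^ N"

lemma wallis_pos: "wallis N > 0"
  by (simp add: wallis_def)

lemma wallis_Suc: "wallis (Suc N) = (2 * real N + 1) / (2 * real N + 2) * wallis N"
proof -
  have 1: "Suc N * (Suc (Suc (2*N)) choose Suc N) = Suc (Suc (2*N)) * (Suc (2*N) choose N)"
    by (rule Suc_times_binomial)
  have 2: "(Suc (2*N) choose N) = (Suc (2*N) choose Suc N)"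
    by (subst binomial_symmetric) auto
  have 3: "Suc N * (Suc (2*N) choose Suc N) = Suc (2*N) * (2*N choose N)"
    by (rule Suc_times_binomial)
  have c: "2 * Suc N = Suc (Suc (2*N))" by simp
  have "real (Suc N) * real (Suc N) * real (2 * Suc N choose Suc N)
        = real (Suc N) * (real (Suc N * (Suc (Suc (2*N)) choose Suc N)))"
    by (subst c) (simp only: of_nat_mult mult_ac)
  also have "\<dots> = real (Suc (Suc (2*N))) * real (Suc N * (Suc (2*N) choose Suc N))"
    by (subst 1, subst 2) (simp only: of_nat_mult mult_ac)
  also have "\<dots> = real (Suc (Suc (2*N))) * real (Suc (2*N)) * real (2*N choose N)"
    by (subst 3) (simp only: of_nat_mult mult_ac)
  also have "\<dots> = real (Suc N) * (2 * (2 * real N + 1) * real (2*N choose N))"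
    by (simp add: algebra_simps)
  finally have "real (Suc N) * real (2 * Suc N choose Suc N) = 2 * (2 * real N + 1) * real (2*N choose N)"
    by (simp only: mult.assoc mult_cancel_left) simp
  then show ?thesis
    unfolding wallis_def
    by (simp add: divide_simps del: binomial_Suc_Suc) (simp add: algebra_simps del: binomial_Suc_Suc)
qed

lemma wave_sq: "wave (\<not> p) t ^ 2 = 1 - wave p t ^ 2"
  using sin_squared_eq[of "pi * t / 2"] cos_squared_eq[of "pi * t / 2"] by (auto simp: wave_def simp del: sin_cos_squared_add)

lemma continuous_on_wave [continuous_intros]:
  fixes f :: "'a::t2_space \<Rightarrow> real"
  shows "continuous_on A f \<Longrightarrow> continuous_on A (\<lambda>x. wave p (f x))"
  unfolding wave_def by (cases p) (simp_all add: continuous_intros)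

lemma wave_power_bounds: "0 \<le> wave p t ^ (2 * N) \<and> wave p t ^ (2 * N) \<le> 1"
proof -
  have "wave p t ^ 2 \<le> 1"
    by (simp add: wave_def abs_square_le_1)
  then show ?thesis by (simp add: power_mult power_le_one)
qed

lemma wave_mult_zero:
  assumes "t \<in> \<int>"
  shows "wave p t * wave (\<not> p) t = 0"
proof -
  have "sin (pi * t / 2) * cos (pi * t / 2) = sin (pi * t) / 2"
    using sin_double[of "pi * t / 2"] by simp
  also have "\<dots> = 0"
    using assms by (auto simp: Ints_def mult.commute sin_zero_iff_int2)
  finally show ?thesis by (cases p) (auto simp: wave_def)
qed

text \<open>Wallis's recursion. Integration by parts produces boundary terms that contain the product
  \<open>sin (pi t / 2) cos (pi t / 2)\<close>; they vanish at all integers, so that the mean value over an interval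
  with integer end points is always the mean value over a full period.\<close>
lemma wave_power_integral:
  assumes "a \<in> \<int>" "b \<in> \<int>" "a \<le> b"
  shows "has_bochner_integral lborel (\<lambda>t. wave p t ^ (2 * N) * indicator {a..b} t) ((b - a) * wallis N)"
proof (induction N)
  case 0
  show ?case using assms(3) by (simp add: has_bochner_integral_iff wallis_def)
next
  case (Suc N)
  define \<sigma> :: real where "\<sigma> = (if p then 1 else - 1)"
  \<comment> \<open>up to the factor that normalises its leading term, \<open>F\<close> is the boundary term of the integration
    by parts, and \<open>f\<close> is its derivative\<close>
  define F where "F = (\<lambda>t. - \<sigma> * (2 / pi) / (2 * real N + 2) * (wave p t ^ (2 * N + 1) * wave (\<not> p) t))"
  define f where "f = (\<lambda>t. wave p t ^ (2 * Suc N) - (2 * real N + 1) / (2 * real N + 2) * wave p t ^ (2 * N))"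
  have d1: "(wave p has_real_derivative \<sigma> * (pi / 2) * wave (\<not> p) t) (at t)" for t
    unfolding wave_def \<sigma>_def by (cases p) (auto intro!: derivative_eq_intros)
  have d2: "(wave (\<not> p) has_real_derivative - \<sigma> * (pi / 2) * wave p t) (at t)" for t
    unfolding wave_def \<sigma>_def by (cases p) (auto intro!: derivative_eq_intros)
  have "(F has_real_derivative - \<sigma> * (2 / pi) / (2 * real N + 2) *
          (real (2 * N + 1) * wave p t ^ (2 * N) * (\<sigma> * (pi / 2) * wave (\<not> p) t) * wave (\<not> p) t
            + wave p t ^ (2 * N + 1) * (- \<sigma> * (pi / 2) * wave p t))) (at t)" for t
    unfolding F_def by (rule derivative_eq_intros d1 d2 refl | simp)+
  moreover have "- \<sigma> * (2 / pi) / (2 * real N + 2) *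
          (real (2 * N + 1) * wave p t ^ (2 * N) * (\<sigma> * (pi / 2) * wave (\<not> p) t) * wave (\<not> p) t
            + wave p t ^ (2 * N + 1) * (- \<sigma> * (pi / 2) * wave p t)) = f t" for t
  proof -
    define w where "w = wave p t ^ (2*N)"
    have ss: "\<sigma> * \<sigma> = 1" by (simp add: \<sigma>_def)
    have "- \<sigma> * (2 / pi) / (2 * real N + 2) *
          (real (2 * N + 1) * wave p t ^ (2 * N) * (\<sigma> * (pi / 2) * wave (\<not> p) t) * wave (\<not> p) t
            + wave p t ^ (2 * N + 1) * (- \<sigma> * (pi / 2) * wave p t))
       = - (\<sigma> * \<sigma>) / (2 * real N + 2) *
          (real (2 * N + 1) * w * wave (\<not> p) t ^ 2 - w * wave p t ^ 2)"
      unfolding w_def by (simp add: divide_simps power2_eq_square) (simp add: algebra_simps)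
    also have "\<dots> = w * wave p t ^ 2 - (2 * real N + 1) / (2 * real N + 2) * w"
      unfolding ss wave_sq by (simp add: field_simps)
    also have "\<dots> = f t" by (simp add: f_def w_def power2_eq_square)
    finally show ?thesis .
  qed
  ultimately have dF: "(F has_real_derivative f t) (at t)" for t by simp
  have "isCont f t" for t
    unfolding f_def wave_def by (cases p) (auto intro!: continuous_intros)
  then have "has_bochner_integral lborel (\<lambda>t. f t * indicator {a..b} t) (F b - F a)"
    using dF assms(3) by (intro has_bochner_integral_FTC_Icc_real)
  moreover have "F t = 0" if "t \<in> \<int>" for t
    using wave_mult_zero[OF that, of p] by (auto simp: F_def)
  ultimately have "has_bochner_integral lborel (\<lambda>t. f t * indicator {a..b} t) 0"
    using assms by simp
  moreover have "has_bochner_integral lborel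
      (\<lambda>t. (2 * real N + 1) / (2 * real N + 2) * (wave p t ^ (2 * N) * indicator {a..b} t))
      ((2 * real N + 1) / (2 * real N + 2) * ((b - a) * wallis N))"
    by (intro has_bochner_integral_mult_right Suc.IH)
  ultimately have "has_bochner_integral lborel (\<lambda>t. f t * indicator {a..b} t +
       (2 * real N + 1) / (2 * real N + 2) * (wave p t ^ (2 * N) * indicator {a..b} t))
      (0 + (2 * real N + 1) / (2 * real N + 2) * ((b - a) * wallis N))"
    by (rule has_bochner_integral_add)
  then
  have "has_bochner_integral lborel (\<lambda>t. wave p t ^ (2 * Suc N) * indicator {a..b} t)
          ((2 * real N + 1) / (2 * real N + 2) * ((b - a) * wallis N))"
    unfolding f_def by (simp add: algebra_simps)
  then show ?case by (simp add: wallis_Suc mult_ac)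
qed

text \<open>The square of the complementary wave measures the distance to the peaks of \<open>wave p ^ (2 * N)\<close>.
  Its mean against this kernel is smaller than the mass by a factor \<open>2 N + 2\<close>; this is the whole
  quantitative content of the concentration of the kernel at its peaks.\<close>
lemma wave_moment_integral:
  assumes "a \<in> \<int>" "b \<in> \<int>" "a \<le> b"
  shows "has_bochner_integral lborel (\<lambda>t. wave (\<not> p) t ^ 2 * wave p t ^ (2 * N) * indicator {a..b} t)
           ((b - a) * wallis N / (2 * real N + 2))"
proof -
  have "has_bochner_integral lborel (\<lambda>t. wave p t ^ (2 * N) * indicator {a..b} t - wave p t ^ (2 * Suc N) * indicator {a..b} t)
           ((b - a) * wallis N - (b - a) * wallis (Suc N))"
    by (intro has_bochner_integral_diff wave_power_integral assms)
  moreover have "(b - a) * wallis N - (b - a) * wallis (Suc N) = (b - a) * wallis N / (2 * real N + 2)"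
    unfolding wallis_Suc by (simp add: field_simps)
  ultimately show ?thesis
    unfolding wave_sq by (simp add: algebra_simps power2_eq_square)
qed

section \<open>Product kernels concentrate on translates of the even lattice\<close>

lemma has_bochner_integral_lborel_prod:
  fixes g :: "'a::euclidean_space \<Rightarrow> real \<Rightarrow> real"
  assumes g: "\<And>b. b \<in> Basis \<Longrightarrow> has_bochner_integral lborel (g b) (v b)"
    and nn: "\<And>b t. b \<in> Basis \<Longrightarrow> g b t \<ge> 0"
  shows "has_bochner_integral lborel (\<lambda>x. \<Prod>b\<in>Basis. g b (x \<bullet> b)) (\<Prod>b\<in>Basis. v b)"
proof (rule has_bochner_integral_nn_integral)
  have m: "g b \<in> borel_measurable borel" if "b \<in> Basis" for b
    using g[OF that] by (auto dest: has_bochner_integral_integrable borel_measurable_integrable)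
  show "(\<lambda>x. \<Prod>b\<in>Basis. g b (x \<bullet> b)) \<in> borel_measurable lborel"
    by (auto intro!: borel_measurable_prod measurable_compose[OF _ m])
  show "AE x in lborel. 0 \<le> (\<Prod>b\<in>Basis. g b (x \<bullet> b))"
    by (auto intro!: prod_nonneg nn)
  have v: "v b \<ge> 0" if "b \<in> Basis" for b
    using has_bochner_integral_integral_eq[OF g[OF that]] nn[OF that]
      Bochner_Integration.integral_nonneg[of "lborel" "g b"] by simp
  then show "0 \<le> (\<Prod>b\<in>Basis. v b)" by (auto intro!: prod_nonneg)
  have 1: "(\<integral>\<^sup>+t. ennreal (g b t) \<partial>lborel) = ennreal (v b)" if "b \<in> Basis" for b
    using g[OF that] nn[OF that]
    by (subst nn_integral_eq_integral) (auto simp: has_bochner_integral_iff)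
  have "(\<integral>\<^sup>+x. ennreal (\<Prod>b\<in>Basis. g b (x \<bullet> b)) \<partial>lborel)
      = (\<integral>\<^sup>+x. (\<Prod>b\<in>Basis. ennreal (g b ((x::'a) \<bullet> b))) \<partial>lborel)"
    by (intro nn_integral_cong) (auto simp: prod_ennreal nn)
  also have "\<dots> = (\<Prod>b\<in>Basis. (\<integral>\<^sup>+t. ennreal (g b t) \<partial>lborel))"
    by (rule nn_integral_lborel_prod) (auto intro!: measurable_compose[OF m])
  also have "\<dots> = ennreal (\<Prod>b\<in>Basis. v b)"
    by (simp add: 1 v prod_ennreal)
  finally show "(\<integral>\<^sup>+x. ennreal (\<Prod>b\<in>Basis. g b (x \<bullet> b)) \<partial>lborel) = ennreal (\<Prod>b\<in>Basis. v b)" .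
qed

text \<open>For large \<open>N\<close> this function is concentrated near the integer points whose set of odd coordinates
  is \<open>C\<close>. These points form a translate of the lattice of points with even coordinates; subsets of the
  standard basis thus index the cosets of the even lattice in the integer lattice.\<close>
definition spike :: "nat \<Rightarrow> 'a::euclidean_space set \<Rightarrow> 'a \<Rightarrow> real" where
  "spike N C x = (\<Prod>b\<in>Basis. wave (b \<in> C) (x \<bullet> b) ^ (2 * N))"

text \<open>A smooth substitute for the squared distance to the peaks of \<open>spike N C\<close>: it vanishes exactly at
  the integer points whose set of odd coordinates is \<open>C\<close>.\<close>
definition defect :: "'a::euclidean_space set \<Rightarrow> 'a \<Rightarrow> real" where
  "defect C x = (\<Sum>b\<in>Basis. wave (b \<notin> C) (x \<bullet> b) ^ 2)"

abbreviation cube :: "nat \<Rightarrow> 'a::euclidean_space set" where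
  "cube L \<equiv> cbox (- (real L *\<^sub>R One)) (real L *\<^sub>R One)"

lemma indicator_cube:
  "indicator (cube L) x = (\<Prod>b\<in>Basis. indicator {- real L..real L} (x \<bullet> b) :: real)"
  by (auto simp: indicator_def cbox_def inner_simps)

lemma spike_nonneg: "spike N C x \<ge> 0"
  unfolding spike_def by (intro prod_nonneg) (auto simp: power_mult)

lemma spike_le_1: "spike N C x \<le> 1"
  unfolding spike_def
  by (intro prod_le_1) (simp add: wave_power_bounds)

lemma defect_nonneg: "defect C x \<ge> 0"
  unfolding defect_def by (intro sum_nonneg) auto

lemma continuous_spike [continuous_intros]: "continuous_on A (spike N C)"
  unfolding spike_def by (intro continuous_intros)

lemma continuous_defect [continuous_intros]: "continuous_on A (defect C)"
  unfolding defect_def by (intro continuous_intros)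

lemma measurable_spike [measurable]: "spike N C \<in> borel_measurable borel"
  by (intro borel_measurable_continuous_onI continuous_intros)

lemma spike_cube_integral:
  "has_bochner_integral lborel (\<lambda>x::'a::euclidean_space. spike N C x * indicator (cube L) x)
     ((2 * real L * wallis N) ^ DIM('a))"
proof -
  have "has_bochner_integral lborel
     (\<lambda>x::'a. \<Prod>b\<in>Basis. wave (b \<in> C) (x \<bullet> b) ^ (2 * N) * indicator {- real L..real L} (x \<bullet> b))
     (\<Prod>b\<in>(Basis::'a set). (real L - (- real L)) * wallis N)"
    by (intro has_bochner_integral_lborel_prod wave_power_integral) (auto simp: power_mult)
  then show ?thesis
    by (simp add: spike_def indicator_cube prod.distrib)
qed

lemma defect_spike_cube_integral:
  "has_bochner_integral lborel (\<lambda>x::'a::euclidean_space. defect C x * spike N C x * indicator (cube L) x)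
     (DIM('a) * (2 * real L * wallis N) ^ DIM('a) / (2 * real N + 2))"
proof -
  have 1: "has_bochner_integral lborel
      (\<lambda>x::'a. wave (c \<notin> C) (x \<bullet> c) ^ 2 * spike N C x * indicator (cube L) x)
      ((2 * real L * wallis N) ^ DIM('a) / (2 * real N + 2))" if c: "c \<in> Basis" for c
  proof -
    have "has_bochner_integral lborel
     (\<lambda>x::'a. \<Prod>b\<in>Basis. (if b = c then wave (\<not> b \<in> C) (x \<bullet> b) ^ 2 * wave (b \<in> C) (x \<bullet> b) ^ (2 * N) * indicator {- real L..real L} (x \<bullet> b)
         else wave (b \<in> C) (x \<bullet> b) ^ (2 * N) * indicator {- real L..real L} (x \<bullet> b)))
     (\<Prod>b\<in>(Basis::'a set). (if b = c then (real L - (- real L)) * wallis N / (2 * real N + 2) else (real L - (- real L)) * wallis N))"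
      (is "has_bochner_integral _ (\<lambda>x. \<Prod>b\<in>Basis. ?g b (x \<bullet> b)) (\<Prod>b\<in>Basis. ?v b)")
    proof (rule has_bochner_integral_lborel_prod)
      show "has_bochner_integral lborel (?g b) (?v b)" for b
        using wave_power_integral[of "- real L" "real L" "b \<in> C" N]
          wave_moment_integral[of "- real L" "real L" "b \<in> C" N] by (cases "b = c") auto
    qed (auto simp: power_mult)
    moreover have "(\<Prod>b\<in>Basis. ?g b (x \<bullet> b)) = wave (c \<notin> C) (x \<bullet> c) ^ 2 * spike N C x * indicator (cube L) x" for x :: 'a
      using c by (simp add: spike_def indicator_cube prod.remove[of Basis c] prod.distrib mult_ac)
    moreover have "(\<Prod>b\<in>Basis. ?v b) = (2 * real L * wallis N) ^ DIM('a) / (2 * real N + 2)"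
    proof -
      obtain d where d: "DIM('a) = Suc d" using DIM_positive[where 'a='a] by (cases "DIM('a)") auto
      show ?thesis using c by (simp add: prod.remove[of Basis c] d)
    qed
    ultimately show ?thesis by simp
  qed
  have "has_bochner_integral lborel
      (\<lambda>x::'a. \<Sum>c\<in>Basis. wave (c \<notin> C) (x \<bullet> c) ^ 2 * spike N C x * indicator (cube L) x)
      (\<Sum>c\<in>(Basis::'a set). (2 * real L * wallis N) ^ DIM('a) / (2 * real N + 2))"
    by (intro has_bochner_integral_sum 1)
  then show ?thesis by (simp add: defect_def sum_distrib_right)
qed

text \<open>Where \<open>\<theta>\<close> exceeds \<open>\<epsilon>\<close>, the function \<open>S\<close> is bounded below by a positive constant, by compactness.
  As in Korovkin's theorem, this reduces the behaviour of a kernel on all continuous functions to its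
  behaviour on \<open>S\<close>.\<close>
lemma compact_penalty:
  fixes \<theta> S :: "'a::topological_space \<Rightarrow> real"
  assumes "compact B" "continuous_on B \<theta>" "continuous_on B S"
    and S: "\<And>x. x \<in> B \<Longrightarrow> S x \<ge> 0" and zero: "\<And>x. x \<in> B \<Longrightarrow> S x = 0 \<Longrightarrow> \<theta> x \<le> 0" and "\<epsilon> > 0"
  shows "\<exists>M\<ge>0. \<forall>x\<in>B. \<theta> x \<le> \<epsilon> + M * S x"
proof -
  define D where "D = B \<inter> \<theta> -` {\<epsilon>..}"
  have "compact D"
  proof -
    have "closedin (top_of_set B) D"
      unfolding D_def by (intro continuous_closedin_preimage assms) auto
    then show ?thesis using closedin_compact assms(1) by blast
  qed
  show ?thesis
  proof (cases "D = {}")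
    case True
    then show ?thesis by (intro exI[of _ 0]) (auto simp: D_def not_le less_imp_le)
  next
    case False
    have cD: "continuous_on D \<theta>" "continuous_on D S"
      using assms by (auto simp: D_def intro: continuous_on_subset)
    obtain x0 where x0: "x0 \<in> D" "\<And>y. y \<in> D \<Longrightarrow> S x0 \<le> S y"
      using continuous_attains_inf[OF \<open>compact D\<close> False cD(2)] by blast
    obtain x1 where x1: "x1 \<in> D" "\<And>y. y \<in> D \<Longrightarrow> \<theta> y \<le> \<theta> x1"
      using continuous_attains_sup[OF \<open>compact D\<close> False cD(1)] by blast
    have pos: "S x0 > 0"
      using x0(1) zero[of x0] S[of x0] \<open>\<epsilon> > 0\<close> by (force simp: D_def)
    have t1: "\<theta> x1 > 0" using x1(1) \<open>\<epsilon> > 0\<close> by (auto simp: D_def)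
    show ?thesis
    proof (intro exI[of _ "\<theta> x1 / S x0"] conjI ballI)
      fix x assume x: "x \<in> B"
      show "\<theta> x \<le> \<epsilon> + \<theta> x1 / S x0 * S x"
      proof (cases "x \<in> D")
        case True
        have "\<theta> x \<le> \<theta> x1 / S x0 * S x0" using x1(2)[OF True] pos by simp
        also have "\<dots> \<le> \<theta> x1 / S x0 * S x"
          using x0(2)[OF True] t1 pos by (intro mult_left_mono) auto
        finally show ?thesis using \<open>\<epsilon> > 0\<close> by simp
      next
        case False
        then have "\<theta> x \<le> \<epsilon>" using x by (auto simp: D_def)
        moreover have "\<theta> x1 / S x0 * S x \<ge> 0" using t1 pos S[OF x] by simp
        ultimately show ?thesis by simp
      qed
    qed (use t1 pos in auto)
  qed
qed

text \<open>A nonzero point with even coordinates has a coordinate of size at least 2, and a point with at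
  least four odd coordinates has square norm at least 4. This is Construction A: distance 4 in the
  discrete cube gives distance 2 in the lattice.\<close>
lemma norm_ge_2_if_defect_zero:
  fixes x :: "'a::euclidean_space"
  assumes "defect C x = 0" "C \<subseteq> Basis" "C = {} \<Longrightarrow> x \<noteq> 0" "C \<noteq> {} \<Longrightarrow> card C \<ge> 4"
  shows "norm x \<ge> 2"
proof -
  have w: "wave (b \<notin> C) (x \<bullet> b) = 0" if "b \<in> Basis" for b
    using assms(1) that unfolding defect_def by (subst (asm) sum_nonneg_eq_0_iff) auto
  show ?thesis
  proof (cases "C = {}")
    case True
    then obtain b where b: "b \<in> Basis" "x \<bullet> b \<noteq> 0"
      using assms(3) by (metis euclidean_all_zero_iff)
    then have "sin (pi * (x \<bullet> b) / 2) = 0" using w[OF b(1)] True by (simp add: wave_def)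
    then obtain i :: int where "pi * (x \<bullet> b) / 2 = of_int i * pi"
      by (auto simp: sin_zero_iff_int2)
    then have i: "x \<bullet> b = 2 * of_int i" by (simp add: field_simps)
    then have "\<bar>x \<bullet> b\<bar> \<ge> 2" using b(2) by (cases "i = 0") auto
    then show ?thesis using Basis_le_norm[OF b(1), of x] by simp
  next
    case False
    have *: "(x \<bullet> b)^2 \<ge> 1" if "b \<in> C" for b
    proof -
      have "cos (pi * (x \<bullet> b) / 2) = 0" using w[of b] that assms(2) by (auto simp: wave_def)
      then obtain i :: int where "odd i" "pi * (x \<bullet> b) / 2 = of_int i * (pi / 2)"
        by (auto simp: cos_zero_iff_int)
      then have "x \<bullet> b = of_int i" "i \<noteq> 0" by (auto simp: field_simps)
      then have "1 \<le> \<bar>x \<bullet> b\<bar>" by auto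
      then show ?thesis using one_le_power[of "\<bar>x \<bullet> b\<bar>" 2] by simp
    qed
    have "4 \<le> real (card C)" using assms(4) False by simp
    also have "\<dots> = (\<Sum>b\<in>C. 1)" by simp
    also have "\<dots> \<le> (\<Sum>b\<in>C. (x \<bullet> b)^2)" by (intro sum_mono *)
    also have "\<dots> \<le> (\<Sum>b\<in>Basis. (x \<bullet> b)^2)" using assms(2) by (intro sum_mono2) auto
    also have "\<dots> = x \<bullet> x"
      unfolding euclidean_inner[of x x] by (simp add: power2_eq_square)
    also have "\<dots> = norm x ^ 2"
      by (simp add: power2_norm_eq_inner)
    finally have "2 ^ 2 \<le> norm x ^ 2" by simp
    then show ?thesis by (rule power2_le_imp_le) simp
  qed
qed

text \<open>Inside the open ball of radius 2 the only peak available is the origin, and it is a peak only for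
  \<open>C = {}\<close>. The factor \<open>2 ^ DIM('a)\<close> is the covolume of the even lattice: in the limit, \<open>spike N C\<close>
  divided by its mean is that multiple of the sum of the point masses at its peaks.\<close>
lemma spike_concentration:
  fixes \<phi> :: "'a::euclidean_space \<Rightarrow> real"
  assumes cont: "continuous_on UNIV \<phi>" and nn: "\<And>x. \<phi> x \<ge> 0" and supp: "\<And>x. norm x \<ge> 2 \<Longrightarrow> \<phi> x = 0"
    and C: "C \<subseteq> Basis" "C \<noteq> {} \<Longrightarrow> card C \<ge> 4" and "\<epsilon> > 0"
  shows "eventually (\<lambda>N. (\<integral>x. \<phi> x * spike N C x \<partial>lborel)
           \<le> wallis N ^ DIM('a) * (2 ^ DIM('a) * (if C = {} then \<phi> 0 else 0) + \<epsilon>)) sequentially"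
proof -
  define n where "n = DIM('a)"
  define \<kappa> where "\<kappa> = (if C = {} then \<phi> 0 else 0)"
  \<comment> \<open>the cube that contains the support of \<open>\<phi>\<close> has volume \<open>4 ^ n\<close>\<close>
  define \<epsilon>' where "\<epsilon>' = \<epsilon> / (2 * 4 ^ n)"
  have "\<epsilon>' > 0" using \<open>\<epsilon> > 0\<close> by (simp add: \<epsilon>'_def)
  have z: "\<phi> x = 0" if "defect C x = 0" "C = {} \<Longrightarrow> x \<noteq> 0" for x
    using norm_ge_2_if_defect_zero[OF that(1) C(1) that(2) C(2)] supp by blast
  have cphi: "continuous_on A \<phi>" for A using cont continuous_on_subset by blast
  \<comment> \<open>on the unit cube around the origin \<open>\<phi>\<close> is compared with its value there, outside with 0\<close>
  have "\<exists>M\<ge>0. \<forall>x\<in>cube 2. \<phi> x - \<kappa> \<le> \<epsilon>' + M * defect C x"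
  proof (rule compact_penalty)
    fix x assume "defect C x = 0"
    then show "\<phi> x - \<kappa> \<le> 0"
      using z[of x] nn[of 0] by (cases "C = {} \<and> x = 0") (auto simp: \<kappa>_def)
  qed (use \<open>\<epsilon>' > 0\<close> in \<open>auto intro!: continuous_intros cphi defect_nonneg\<close>)
  then obtain M1 where M1: "M1 \<ge> 0" "\<And>x. x \<in> cube 2 \<Longrightarrow> \<phi> x - \<kappa> \<le> \<epsilon>' + M1 * defect C x"
    by blast
  have "\<exists>M\<ge>0. \<forall>x\<in>cube 2 - box (- One) One. \<phi> x \<le> \<epsilon>' + M * defect C x"
  proof (rule compact_penalty)
    fix x :: 'a assume "defect C x = 0" "x \<in> cube 2 - box (- One) One"
    then show "\<phi> x \<le> 0" using z[of x] by (cases "x = 0") (auto simp: box_def)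
  qed (use \<open>\<epsilon>' > 0\<close> in \<open>auto intro!: continuous_intros cphi defect_nonneg compact_diff\<close>)
  then obtain M2 where M2: "M2 \<ge> 0" "\<And>x. x \<in> cube 2 - box (- One) One \<Longrightarrow> \<phi> x \<le> \<epsilon>' + M2 * defect C x"
    by blast
  define M where "M = max M1 M2"
  have M: "M \<ge> 0" "M1 * defect C x \<le> M * defect C x" "M2 * defect C x \<le> M * defect C x" for x
    using M1(1) by (auto simp: M_def intro!: mult_right_mono defect_nonneg)
  have k0: "\<kappa> \<ge> 0" using nn by (simp add: \<kappa>_def)
  have major: "\<phi> x \<le> \<kappa> * indicator (cube 1) x + (\<epsilon>' + M * defect C x) * indicator (cube 2) x" for x
  proof (cases "x \<in> cube 2")
    case True
    show ?thesis
    proof (cases "x \<in> cube 1")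
      case t: True
      show ?thesis using M1(2)[OF True] M(2)[of x] True t by simp
    next
      case False
      then have "x \<notin> box (- One) One" by (auto simp: box_def cbox_def intro: less_imp_le)
      then show ?thesis using M2(2)[of x] M(3)[of x] True False by simp
    qed
  next
    case False
    then obtain b where b: "b \<in> Basis" "\<not> (- 2 \<le> x \<bullet> b \<and> x \<bullet> b \<le> 2)"
      by (auto simp: cbox_def inner_simps)
    then have "norm x \<ge> 2" using Basis_le_norm[OF b(1), of x] by auto
    then show ?thesis using supp k0 False by simp
  qed
  have bound: "(\<integral>x. \<phi> x * spike N C x \<partial>lborel) \<le> 
      wallis N ^ n * (2 ^ n * \<kappa> + \<epsilon> / 2 + 4 ^ n * M * real n / (2 * real N + 2))" for N
  proof -
    have hb: "has_bochner_integral lborel (\<lambda>x. \<kappa> * (spike N C x * indicator (cube 1) x) +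
         (\<epsilon>' * (spike N C x * indicator (cube 2) x) + M * (defect C x * spike N C x * indicator (cube 2) x)))
       (\<kappa> * (2 * real 1 * wallis N) ^ DIM('a) + (\<epsilon>' * (2 * real 2 * wallis N) ^ DIM('a)
          + M * (DIM('a) * (2 * real 2 * wallis N) ^ DIM('a) / (2 * real N + 2))))"
      by (intro has_bochner_integral_add has_bochner_integral_mult_right
           spike_cube_integral defect_spike_cube_integral)
    have "(\<integral>x. \<phi> x * spike N C x \<partial>lborel) \<le> (\<integral>x. \<kappa> * (spike N C x * indicator (cube 1) x) +
         (\<epsilon>' * (spike N C x * indicator (cube 2) x) + M * (defect C x * spike N C x * indicator (cube 2) x)) \<partial>lborel)"
    proof (rule integral_mono')
      show "integrable lborel (\<lambda>x. \<kappa> * (spike N C x * indicator (cube 1) x) +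
         (\<epsilon>' * (spike N C x * indicator (cube 2) x) + M * (defect C x * spike N C x * indicator (cube 2) x)))"
        using hb by (simp add: has_bochner_integral_iff)
      fix x
      show "\<phi> x * spike N C x \<le> \<kappa> * (spike N C x * indicator (cube 1) x) +
         (\<epsilon>' * (spike N C x * indicator (cube 2) x) + M * (defect C x * spike N C x * indicator (cube 2) x))"
        using mult_right_mono[OF major[of x] spike_nonneg[of N C x]] by (simp add: algebra_simps)
      then show "0 \<le> \<kappa> * (spike N C x * indicator (cube 1) x) +
         (\<epsilon>' * (spike N C x * indicator (cube 2) x) + M * (defect C x * spike N C x * indicator (cube 2) x))"
        using mult_nonneg_nonneg[OF nn[of x] spike_nonneg[of N C x]] by linarith
    qed
    also have "\<dots> = \<kappa> * (2 * real 1 * wallis N) ^ DIM('a) + (\<epsilon>' * (2 * real 2 * wallis N) ^ DIM('a)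
          + M * (DIM('a) * (2 * real 2 * wallis N) ^ DIM('a) / (2 * real N + 2)))"
      using hb by (simp add: has_bochner_integral_iff)
    also have "\<dots> = wallis N ^ n * (2 ^ n * \<kappa> + \<epsilon> / 2 + 4 ^ n * M * real n / (2 * real N + 2))"
      by (simp add: \<epsilon>'_def n_def power_mult_distrib field_simps)
    finally show ?thesis .
  qed
  have "(\<lambda>N. 4 ^ n * M * real n / (2 * real N + 2)) \<longlonglongrightarrow> 0"
  proof -
    have "(\<lambda>N. 4 ^ n * M * real n / 2 * inverse (real (Suc N))) \<longlonglongrightarrow> 0"
      by (rule tendsto_mult_right_zero[OF LIMSEQ_inverse_real_of_nat])
    then show ?thesis by (simp add: field_simps)
  qed
  then have "eventually (\<lambda>N. 4 ^ n * M * real n / (2 * real N + 2) < \<epsilon> / 2) sequentially"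
    using \<open>\<epsilon> > 0\<close> by (intro order_tendstoD(2)) auto
  then show ?thesis
  proof eventually_elim
    case (elim N)
    have "(\<integral>x. \<phi> x * spike N C x \<partial>lborel) \<le> 
      wallis N ^ n * (2 ^ n * \<kappa> + \<epsilon> / 2 + 4 ^ n * M * real n / (2 * real N + 2))"
      by (rule bound)
    also have "\<dots> \<le> wallis N ^ n * (2 ^ n * \<kappa> + \<epsilon>)"
    proof (rule mult_left_mono)
      show "2 ^ n * \<kappa> + \<epsilon> / 2 + 4 ^ n * M * real n / (2 * real N + 2) \<le> 2 ^ n * \<kappa> + \<epsilon>"
        using elim by linarith
    qed (use wallis_pos[of N] in simp)
    finally show ?case by (simp add: n_def \<kappa>_def)
  qed
qed

section \<open>The comb as a trigonometric polynomial\<close>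

definition wave_coeff :: "bool \<Rightarrow> nat \<Rightarrow> nat \<Rightarrow> real" where
  "wave_coeff p N j = (if p then (- 1) ^ (N + j) else 1) * (real ((2 * N) choose j) / 4 ^ N)"

text \<open>Euler's formula and the binomial theorem. The frequencies are half-integers because the kernel has
  period 2, and the exponentials are written as in \<open>fourier\<close>.\<close>
lemma wave_power_expansion:
  "complex_of_real (wave p t ^ (2 * N)) =
     (\<Sum>j\<le>2 * N. complex_of_real (wave_coeff p N j) *
        exp (- 2 * pi * \<i> * complex_of_real (t * ((real N - real j) / 2))))"
proof -
  define u v where "u = exp (\<i> * of_real (pi * t / 2))" and "v = exp (- (\<i> * of_real (pi * t / 2)))"
  have uv: "u ^ j * v ^ (2 * N - j) = exp (- 2 * pi * \<i> * complex_of_real (t * ((real N - real j) / 2)))"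
    if "j \<le> 2 * N" for j
  proof -
    have "u ^ j * v ^ (2 * N - j) = exp (of_nat j * (\<i> * of_real (pi * t / 2)) + of_nat (2 * N - j) * - (\<i> * of_real (pi * t / 2)))"
      unfolding u_def v_def exp_of_nat_mult[symmetric] exp_add[symmetric] ..
    also have "of_nat j * (\<i> * of_real (pi * t / 2)) + of_nat (2 * N - j) * - (\<i> * of_real (pi * t / 2))
       = - 2 * pi * \<i> * complex_of_real (t * ((real N - real j) / 2))"
      using that by (simp add: of_nat_diff field_simps)
    finally show ?thesis .
  qed
  show ?thesis
  proof (cases p)
    case False
    have "complex_of_real (wave p t) = (u + v) / 2"
      using False by (simp add: wave_def u_def v_def cos_of_real[symmetric] cos_exp_eq)
    then have "complex_of_real (wave p t ^ (2 * N)) = ((u + v) / 2) ^ (2 * N)"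
      by (simp only: of_real_power)
    also have "\<dots> = (u + v) ^ (2 * N) / 4 ^ N"
      by (simp add: power_divide power_mult)
    also have "\<dots> = (\<Sum>j\<le>2 * N. of_nat (2 * N choose j) * u ^ j * v ^ (2 * N - j)) / 4 ^ N"
      by (simp only: binomial_ring)
    also have "\<dots> = (\<Sum>j\<le>2 * N. complex_of_real (wave_coeff p N j) * (u ^ j * v ^ (2 * N - j)))"
      using False by (simp add: sum_divide_distrib wave_coeff_def mult.assoc)
    finally show ?thesis by (simp add: uv)
  next
    case True
    have "complex_of_real (wave p t) = (u - v) / (2 * \<i>)"
      using True by (simp add: wave_def u_def v_def sin_of_real[symmetric] sin_exp_eq)
    then have "complex_of_real (wave p t ^ (2 * N)) = ((u - v) / (2 * \<i>)) ^ (2 * N)"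
      by (simp only: of_real_power)
    moreover have "((u - v) / (2 * \<i>))\<^sup>2 = (u + - v)\<^sup>2 / (- 4)"
      by (simp add: power_divide power_mult_distrib)
    then have "((u - v) / (2 * \<i>)) ^ (2 * N) = (u + - v) ^ (2 * N) / (- 4) ^ N"
      by (simp only: power_mult power_divide)
    ultimately have "complex_of_real (wave p t ^ (2 * N)) = (u + - v) ^ (2 * N) / (- 4) ^ N"
      by simp
    also have "\<dots> = (\<Sum>j\<le>2 * N. of_nat (2 * N choose j) * u ^ j * (- v) ^ (2 * N - j)) / (- 4) ^ N"
      by (simp only: binomial_ring)
    also have "\<dots> = (\<Sum>j\<le>2 * N. complex_of_real (wave_coeff p N j) * (u ^ j * v ^ (2 * N - j)))"
      unfolding sum_divide_distrib
    proof (rule sum.cong)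
      fix j assume "j \<in> {..2 * N}"
      then have "(- 1 :: complex) ^ (2 * N - j) = (- 1) ^ j"
        by (simp add: minus_one_power_iff)
      then have "(- v) ^ (2 * N - j) = (- 1) ^ j * v ^ (2 * N - j)"
        by (subst power_minus) simp
      moreover have "(- 4 :: complex) ^ N = (- 1) ^ N * 4 ^ N"
        by (rule power_minus)
      moreover have "(1 :: complex) / (- 1) ^ N = (- 1) ^ N"
        by (simp add: minus_one_power_iff)
      ultimately show "of_nat (2 * N choose j) * u ^ j * (- v) ^ (2 * N - j) / (- 4) ^ N
          = complex_of_real (wave_coeff p N j) * (u ^ j * v ^ (2 * N - j))"
        using True by (simp add: wave_coeff_def power_add field_simps)
    qed simp
    finally show ?thesis by (simp add: uv)
  qed
qed

text \<open>This is the Fourier transform on the group of subsets of \<open>B\<close> under symmetric difference, that is,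
  on the integer lattice modulo the even lattice.\<close>
definition character_sum :: "('a set \<Rightarrow> real) \<Rightarrow> 'a set \<Rightarrow> 'a set \<Rightarrow> real" where
  "character_sum h B J = (\<Sum>C\<in>Pow B. h C * (- 1) ^ card (C \<inter> J))"

lemma spike_expansion:
  fixes x :: "'a::euclidean_space"
  shows "complex_of_real (spike N C x) =
     (\<Sum>g\<in>Basis \<rightarrow>\<^sub>E {..2 * N}. complex_of_real ((\<Prod>b\<in>Basis. wave_coeff (b \<in> C) N (g b))) *
        exp (- 2 * pi * \<i> * complex_of_real (x \<bullet> (\<Sum>b\<in>Basis. ((real N - real (g b)) / 2) *\<^sub>R b))))"
proof -
  have "complex_of_real (spike N C x) = (\<Prod>b\<in>Basis. complex_of_real (wave (b \<in> C) (x \<bullet> b) ^ (2 * N)))"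
    by (simp add: spike_def)
  also have "\<dots> = (\<Prod>b\<in>Basis. \<Sum>j\<le>2 * N. complex_of_real (wave_coeff (b \<in> C) N j) *
        exp (- 2 * pi * \<i> * complex_of_real ((x \<bullet> b) * ((real N - real j) / 2))))"
    by (simp only: wave_power_expansion)
  also have "\<dots> = (\<Sum>g\<in>Basis \<rightarrow>\<^sub>E {..2 * N}. \<Prod>b\<in>Basis. complex_of_real (wave_coeff (b \<in> C) N (g b)) *
        exp (- 2 * pi * \<i> * complex_of_real ((x \<bullet> b) * ((real N - real (g b)) / 2))))"
    by (rule prod_sum_PiE) auto
  also have "\<dots> = (\<Sum>g\<in>Basis \<rightarrow>\<^sub>E {..2 * N}. complex_of_real (\<Prod>b\<in>Basis. wave_coeff (b \<in> C) N (g b)) *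
        exp (- 2 * pi * \<i> * complex_of_real (x \<bullet> (\<Sum>b\<in>Basis. ((real N - real (g b)) / 2) *\<^sub>R b))))"
  proof (rule sum.cong[OF refl])
    fix g :: "'a \<Rightarrow> nat"
    have "(\<Prod>b\<in>Basis. exp (- 2 * pi * \<i> * complex_of_real ((x \<bullet> b) * ((real N - real (g b)) / 2))))
        = exp (\<Sum>b\<in>Basis. - 2 * pi * \<i> * complex_of_real ((x \<bullet> b) * ((real N - real (g b)) / 2)))"
      by (simp only: exp_sum finite_Basis)
    also have "(\<Sum>b\<in>Basis. - 2 * pi * \<i> * complex_of_real ((x \<bullet> b) * ((real N - real (g b)) / 2)))
        = - 2 * pi * \<i> * complex_of_real (x \<bullet> (\<Sum>b\<in>Basis. ((real N - real (g b)) / 2) *\<^sub>R b))"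
      unfolding sum_distrib_left[symmetric] of_real_sum[symmetric] inner_sum_right
      by (simp add: mult.commute)
    finally show "(\<Prod>b\<in>Basis. complex_of_real (wave_coeff (b \<in> C) N (g b)) *
        exp (- 2 * pi * \<i> * complex_of_real ((x \<bullet> b) * ((real N - real (g b)) / 2))))
      = complex_of_real (\<Prod>b\<in>Basis. wave_coeff (b \<in> C) N (g b)) *
        exp (- 2 * pi * \<i> * complex_of_real (x \<bullet> (\<Sum>b\<in>Basis. ((real N - real (g b)) / 2) *\<^sub>R b)))"
      by (simp add: prod.distrib)
  qed
  finally show ?thesis .
qed

text \<open>The coefficients of the kernels for different \<open>C\<close> agree up to sign, because the kernels are
  translates of each other by integer points; the sign is a character of the group of subsets,
  evaluated at \<open>C\<close>.\<close>
lemma prod_wave_coeff: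
  assumes "C \<subseteq> Basis"
  shows "(\<Prod>b\<in>(Basis::'a::euclidean_space set). wave_coeff (b \<in> C) N (g b)) =
     (- 1) ^ card (C \<inter> {b \<in> Basis. odd (N + g b)}) * (\<Prod>b\<in>(Basis::'a set). real ((2 * N) choose g b) / 4 ^ N)"
proof -
  have fC: "finite C" using assms finite_Basis finite_subset by blast
  have "(\<Prod>b\<in>(Basis::'a set). if b \<in> C then (- 1) ^ (N + g b) else (1::real))
      = (\<Prod>b\<in>C. (- 1) ^ (N + g b))"
    using assms by (simp add: prod.inter_restrict[symmetric] Int_absorb1)
  also have "\<dots> = (\<Prod>b\<in>C. if odd (N + g b) then - 1 else 1)"
    by (intro prod.cong) (auto simp: minus_one_power_iff)
  also have "\<dots> = (\<Prod>b\<in>C \<inter> {b \<in> Basis. odd (N + g b)}. - 1)"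
    using assms fC by (subst prod.inter_restrict) (auto intro!: prod.cong)
  also have "\<dots> = (- 1) ^ card (C \<inter> {b \<in> Basis. odd (N + g b)})" by simp
  finally show ?thesis unfolding wave_coeff_def prod.distrib by simp
qed

text \<open>A trigonometric polynomial that approximates the sum of point masses on the integer lattice in
  which a point with set \<open>C\<close> of odd coordinates has weight \<open>h C\<close>.\<close>
definition comb :: "('a set \<Rightarrow> real) \<Rightarrow> nat \<Rightarrow> 'a::euclidean_space \<Rightarrow> real" where
  "comb h N x = (\<Sum>C\<in>Pow Basis. h C * spike N C x)"

lemma comb_expansion:
  fixes x :: "'a::euclidean_space"
  shows "complex_of_real (comb h N x) =
     (\<Sum>g\<in>Basis \<rightarrow>\<^sub>E {..2 * N}. complex_of_real
        (character_sum h Basis {b \<in> Basis. odd (N + g b)} * (\<Prod>b\<in>(Basis::'a set). real ((2 * N) choose g b) / 4 ^ N)) *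
        exp (- 2 * pi * \<i> * complex_of_real (x \<bullet> (\<Sum>b\<in>Basis. ((real N - real (g b)) / 2) *\<^sub>R b))))"
proof -
  have "complex_of_real (comb h N x) = (\<Sum>C\<in>Pow Basis. \<Sum>g\<in>Basis \<rightarrow>\<^sub>E {..2 * N}. 
        complex_of_real (h C * (- 1) ^ card (C \<inter> {b \<in> Basis. odd (N + g b)}) * (\<Prod>b\<in>(Basis::'a set). real ((2 * N) choose g b) / 4 ^ N)) *
        exp (- 2 * pi * \<i> * complex_of_real (x \<bullet> (\<Sum>b\<in>Basis. ((real N - real (g b)) / 2) *\<^sub>R b))))"
    unfolding comb_def of_real_sum of_real_mult[of "h _"] spike_expansion sum_distrib_left
    by (intro sum.cong refl) (simp only: prod_wave_coeff Pow_iff of_real_mult mult.assoc)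
  then show ?thesis
    by (subst (asm) sum.swap) (simp only: character_sum_def of_real_sum sum_distrib_right of_real_mult)
qed

lemma Re_fourier:
  assumes "integrable lborel f"
  shows "has_bochner_integral lborel (\<lambda>x. f x * cos (2 * pi * (x \<bullet> y))) (Re (fourier f y))"
proof -
  have e: "complex_of_real (f x) * exp (- 2 * pi * \<i> * complex_of_real (x \<bullet> y)) = complex_of_real (f x) * cis (- (2 * pi * (x \<bullet> y)))" for x
    by (simp add: cis_conv_exp mult_ac)
  have "integrable lborel (\<lambda>x. complex_of_real (f x) * cis (- (2 * pi * (x \<bullet> y))))"
  proof (rule Bochner_Integration.integrable_bound)
    show "integrable lborel f" by fact
    have "(\<lambda>x. cis (- (2 * pi * (x \<bullet> y)))) \<in> borel_measurable borel"
      by (intro borel_measurable_continuous_onI continuous_intros)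
    then show "(\<lambda>x. complex_of_real (f x) * cis (- (2 * pi * (x \<bullet> y)))) \<in> borel_measurable lborel"
      using borel_measurable_integrable[OF assms] by simp
  qed (simp add: norm_mult)
  then have i: "integrable lborel (\<lambda>x. complex_of_real (f x) * exp (- 2 * pi * \<i> * complex_of_real (x \<bullet> y)))"
    by (simp only: e)
  then have "has_bochner_integral lborel (\<lambda>x. complex_of_real (f x) * exp (- 2 * pi * \<i> * complex_of_real (x \<bullet> y))) (fourier f y)"
    unfolding fourier_def by (simp add: has_bochner_integral_iff)
  from has_bochner_integral_bounded_linear[OF bounded_linear_Re this]
  show ?thesis unfolding e by simp
qed

text \<open>This is the Fourier half of the argument. The comb is a finite combination of exponentials, so its
  integral against \<open>f\<close> is a finite combination of values of the Fourier transform of \<open>f\<close>, and all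
  coefficients are nonnegative. Hence the term of frequency 0 alone is a lower bound.\<close>
lemma comb_integral_ge:
  fixes f :: "'a::euclidean_space \<Rightarrow> real"
  assumes f: "integrable lborel f" and pos: "\<And>y. Re (fourier f y) \<ge> 0"
    and h: "\<And>J. J \<subseteq> Basis \<Longrightarrow> character_sum h Basis J \<ge> 0"
  shows "wallis N ^ DIM('a) * (\<Sum>C\<in>Pow Basis. h C) * Re (fourier f 0) \<le> (\<integral>x. f x * comb h N x \<partial>lborel)"
proof -
  define G where "G = ((Basis::'a set) \<rightarrow>\<^sub>E {..2 * N})"
  define A where "A g = character_sum h Basis {b \<in> (Basis::'a set). odd (N + g b)} * (\<Prod>b\<in>(Basis::'a set). real ((2 * N) choose g b) / 4 ^ N)" for g
  define y where "y g = (\<Sum>b\<in>(Basis::'a set). ((real N - real (g b)) / 2) *\<^sub>R b)" for g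
  have fin: "finite G" unfolding G_def by (intro finite_PiE) auto
  have "comb h N x = (\<Sum>g\<in>G. A g * cos (2 * pi * (x \<bullet> y g)))" for x
  proof -
    have "comb h N x = Re (complex_of_real (comb h N x))" by simp
    also have "\<dots> = (\<Sum>g\<in>G. Re (complex_of_real (A g) * exp (- 2 * pi * \<i> * complex_of_real (x \<bullet> y g))))"
      unfolding comb_expansion G_def A_def y_def by (rule Re_sum)
    also have "\<dots> = (\<Sum>g\<in>G. A g * cos (2 * pi * (x \<bullet> y g)))"
      by (simp add: Re_exp)
    finally show ?thesis .
  qed
  then have "(\<lambda>x. f x * comb h N x) = (\<lambda>x. \<Sum>g\<in>G. A g * (f x * cos (2 * pi * (x \<bullet> y g))))"
    by (simp add: sum_distrib_left mult_ac)
  moreover have "has_bochner_integral lborel (\<lambda>x. \<Sum>g\<in>G. A g * (f x * cos (2 * pi * (x \<bullet> y g)))) (\<Sum>g\<in>G. A g * Re (fourier f (y g)))"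
    by (intro has_bochner_integral_sum has_bochner_integral_mult_right Re_fourier f)
  ultimately have eq: "(\<integral>x. f x * comb h N x \<partial>lborel) = (\<Sum>g\<in>G. A g * Re (fourier f (y g)))"
    by (simp add: has_bochner_integral_iff)
  \<comment> \<open>the index of the frequency 0, since the exponents are shifted by \<open>N\<close>\<close>
  define g0 where "g0 = restrict (\<lambda>_. N) (Basis::'a set)"
  have g0: "g0 \<in> G" by (auto simp: g0_def G_def)
  have "y g0 = 0" by (simp add: y_def g0_def)
  moreover have "A g0 = (\<Sum>C\<in>Pow Basis. h C) * wallis N ^ DIM('a)"
  proof -
    have "{b \<in> Basis. odd (N + g0 b)} = {}" by (simp add: g0_def)
    moreover have "(\<Prod>b\<in>(Basis::'a set). real ((2 * N) choose g0 b) / 4 ^ N) = wallis N ^ DIM('a)"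
      by (simp add: g0_def wallis_def)
    ultimately show ?thesis by (simp only: A_def character_sum_def) simp
  qed
  moreover have "A g * Re (fourier f (y g)) \<ge> 0" for g
    unfolding A_def by (intro mult_nonneg_nonneg h pos prod_nonneg) auto
  then have "A g0 * Re (fourier f (y g0)) \<le> (\<Sum>g\<in>G. A g * Re (fourier f (y g)))"
    using g0 fin by (intro member_le_sum) auto
  ultimately show ?thesis by (simp add: eq mult_ac)
qed

section \<open>Dual bounds from weights on the discrete cube\<close>

text \<open>The two halves meet. From below, the integral of \<open>f\<close> against the comb is controlled by the Fourier
  transform at 0. From above, \<open>f\<close> may be replaced by its positive part, which vanishes outside the
  open ball of radius 2, where the comb has no peak except at the origin. Both bounds carry the same factor
  \<open>wallis N ^ DIM('a)\<close>, which cancels.\<close>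
lemma lattice_dual_bound:
  fixes f :: "'a::euclidean_space \<Rightarrow> real" and h :: "'a set \<Rightarrow> real"
  assumes cont: "continuous_on UNIV f" and int: "integrable lborel f"
    and f0: "f 0 \<ge> 0" and neg: "\<And>x. norm x \<ge> 2 \<Longrightarrow> f x \<le> 0" and pos: "\<And>y. Re (fourier f y) \<ge> 0"
    and h_nonneg: "\<And>C. C \<subseteq> Basis \<Longrightarrow> h C \<ge> 0"
    and h_supp: "\<And>C. C \<subseteq> Basis \<Longrightarrow> C \<noteq> {} \<Longrightarrow> h C \<noteq> 0 \<Longrightarrow> card C \<ge> 4"
    and h_dual: "\<And>J. J \<subseteq> Basis \<Longrightarrow> character_sum h Basis J \<ge> 0"
  shows "(\<Sum>C\<in>Pow Basis. h C) * Re (fourier f 0) \<le> 2 ^ DIM('a) * h {} * f 0"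
proof (rule field_le_epsilon)
  fix \<epsilon> :: real assume "\<epsilon> > 0"
  define S where "S = (\<Sum>C\<in>Pow (Basis :: 'a set). h C)"
  have S: "S \<ge> 0" unfolding S_def using h_nonneg by (intro sum_nonneg) auto
  define \<delta> where "\<delta> = \<epsilon> / (S + 1)"
  have \<delta>: "\<delta> > 0" using S \<open>\<epsilon> > 0\<close> by (simp add: \<delta>_def)
  define \<phi> where "\<phi> x = max 0 (f x)" for x
  have cphi: "continuous_on UNIV \<phi>"
    unfolding \<phi>_def by (intro continuous_intros cont)
  have \<phi>: "\<phi> x \<ge> 0" "f x \<le> \<phi> x" "norm x \<ge> 2 \<Longrightarrow> \<phi> x = 0" "\<phi> 0 = f 0" for x
    using neg[of x] f0 by (auto simp: \<phi>_def)
  have iphi: "integrable lborel (\<lambda>x. \<phi> x * spike N C x)" for N C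
  proof (rule Bochner_Integration.integrable_bound)
    show "integrable lborel f" by fact
    show "(\<lambda>x. \<phi> x * spike N C x) \<in> borel_measurable lborel"
      using borel_measurable_integrable[OF int] by (simp add: \<phi>_def)
    have "\<bar>\<phi> x * spike N C x\<bar> \<le> \<bar>f x\<bar> * 1" for x
      unfolding abs_mult using spike_nonneg[of N C x] spike_le_1[of N C x]
      by (intro mult_mono) (auto simp: \<phi>_def)
    then show "AE x in lborel. norm (\<phi> x * spike N C x) \<le> norm (f x)" by simp
  qed
  have "eventually (\<lambda>N. \<forall>C\<in>{C\<in>Pow Basis. h C \<noteq> 0}. (\<integral>x. \<phi> x * spike N C x \<partial>lborel)
           \<le> wallis N ^ DIM('a) * (2 ^ DIM('a) * (if C = {} then \<phi> 0 else 0) + \<delta>)) sequentially"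
    using h_supp by (intro eventually_ball_finite ballI spike_concentration cphi \<phi> \<delta>) auto
  then obtain N where N: "\<And>C. C \<subseteq> Basis \<Longrightarrow> h C \<noteq> 0 \<Longrightarrow> (\<integral>x. \<phi> x * spike N C x \<partial>lborel)
           \<le> wallis N ^ DIM('a) * (2 ^ DIM('a) * (if C = {} then \<phi> 0 else 0) + \<delta>)"
    by (auto simp: eventually_sequentially)
  have comb_eq: "\<phi> x * comb h N x = (\<Sum>C\<in>Pow Basis. h C * (\<phi> x * spike N C x))" for x
    by (simp add: comb_def sum_distrib_left mult_ac)
  have comb_nonneg: "comb h N x \<ge> 0" for x :: 'a
    unfolding comb_def by (intro sum_nonneg mult_nonneg_nonneg h_nonneg spike_nonneg) auto
  have "wallis N ^ DIM('a) * S * Re (fourier f 0) \<le> (\<integral>x. f x * comb h N x \<partial>lborel)"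
    unfolding S_def by (intro comb_integral_ge int pos h_dual)
  also have "\<dots> \<le> (\<integral>x. \<phi> x * comb h N x \<partial>lborel)"
  proof (rule integral_mono')
    show "integrable lborel (\<lambda>x. \<phi> x * comb h N x)"
      unfolding comb_eq by (intro Bochner_Integration.integrable_sum integrable_mult_right iphi)
  qed (auto intro!: mult_right_mono mult_nonneg_nonneg \<phi> comb_nonneg)
  also have "\<dots> = (\<Sum>C\<in>Pow Basis. h C * (\<integral>x. \<phi> x * spike N C x \<partial>lborel))"
    unfolding comb_eq by (simp add: integral_sum iphi)
  also have "\<dots> \<le> (\<Sum>C\<in>Pow Basis. h C * (wallis N ^ DIM('a) * (2 ^ DIM('a) * (if C = {} then \<phi> 0 else 0) + \<delta>)))"
  proof (intro sum_mono)
    fix C :: "'a set" assume "C \<in> Pow Basis"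
    then show "h C * (\<integral>x. \<phi> x * spike N C x \<partial>lborel)
        \<le> h C * (wallis N ^ DIM('a) * (2 ^ DIM('a) * (if C = {} then \<phi> 0 else 0) + \<delta>))"
      using N[of C] h_nonneg[of C] by (cases "h C = 0") (auto intro!: mult_left_mono)
  qed
  also have "\<dots> = (\<Sum>C\<in>Pow (Basis :: 'a set). (if C = {} then wallis N ^ DIM('a) * (2 ^ DIM('a) * h {} * f 0) else 0)
       + wallis N ^ DIM('a) * \<delta> * h C)"
    by (intro sum.cong refl) (auto simp: \<phi> algebra_simps)
  also have "\<dots> = wallis N ^ DIM('a) * (2 ^ DIM('a) * h {} * f 0 + \<delta> * S)"
    by (simp add: sum.distrib S_def flip: sum_distrib_left) (simp add: algebra_simps)
  finally have "wallis N ^ DIM('a) * (S * Re (fourier f 0)) \<le> wallis N ^ DIM('a) * (2 ^ DIM('a) * h {} * f 0 + \<delta> * S)"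
    by (simp add: mult.assoc)
  then have "S * Re (fourier f 0) \<le> 2 ^ DIM('a) * h {} * f 0 + \<delta> * S"
    using wallis_pos[of N] by simp
  also have "\<delta> * S \<le> \<epsilon>"
    using S \<open>\<epsilon> > 0\<close> by (simp add: \<delta>_def field_simps)
  finally show "(\<Sum>C\<in>Pow Basis. h C) * Re (fourier f 0) \<le> 2 ^ DIM('a) * h {} * f 0 + \<epsilon>"
    by (simp add: S_def)
qed

section \<open>Rescaling\<close>

lemma fourier_scaleR:
  fixes f :: "'a::euclidean_space \<Rightarrow> real"
  assumes [measurable]: "f \<in> borel_measurable borel" and s: "s > 0"
  shows "fourier (\<lambda>x. f (s *\<^sub>R x)) y = of_real (1 / s ^ DIM('a)) * fourier f (y /\<^sub>R s)"
proof -
  define k where "k x = complex_of_real (f x) * exp (- 2 * pi * \<i> * complex_of_real (x \<bullet> (y /\<^sub>R s)))" for x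
  have [measurable]: "(\<lambda>x. exp (- 2 * pi * \<i> * complex_of_real (x \<bullet> (y /\<^sub>R s)))) \<in> borel_measurable borel"
    by (intro borel_measurable_continuous_onI continuous_intros)
  have k [measurable]: "k \<in> borel_measurable borel"
    unfolding k_def by measurable
  have "fourier f (y /\<^sub>R s) = (\<integral>x. k x \<partial>lborel)"
    by (simp add: fourier_def k_def)
  also have "\<dots> = (\<integral>x. k x \<partial>density (distr lborel borel (\<lambda>x. 0 + s *\<^sub>R x)) (\<lambda>_. \<bar>s\<bar> ^ DIM('a)))"
    using s by (subst lborel_affine[of s 0]) auto
  also have "\<dots> = s ^ DIM('a) *\<^sub>R (\<integral>x. k (s *\<^sub>R x) \<partial>lborel)"
    using s by (simp add: integral_density integral_distr)
  also have "(\<integral>x. k (s *\<^sub>R x) \<partial>lborel) = fourier (\<lambda>x. f (s *\<^sub>R x)) y"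
  proof -
    have "(s *\<^sub>R x) \<bullet> (y /\<^sub>R s) = x \<bullet> y" for x using s by simp
    then show ?thesis by (simp only: fourier_def k_def)
  qed
  finally show ?thesis using s by (simp add: scaleR_conv_of_real)
qed

section \<open>A feasible distance distribution of length 10 and distance 4\<close>

text \<open>The weight of one vertex of the discrete cube of dimension 10 in a solution of Delsarte's linear
  program for binary codes of length 10 and minimal distance 4. Multiplied by the number of vertices of
  weight \<open>w\<close>, it gives the distance distribution 1, 70/3, 40/3, 5 at the weights 0, 4, 6, 8. Its sum
  is 128/3, although it belongs to no actual code.\<close>
definition delsarte :: "nat \<Rightarrow> real" where
  "delsarte w = (if w = 0 then 1 else if w = 4 \<or> w = 8 then 1 / 9 else if w = 6 then 4 / 63 else 0)"

text \<open>The generating function of the Krawtchouk polynomials.\<close>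
lemma signed_subset_polynomial:
  assumes "finite B" "J \<subseteq> B"
  shows "(\<Sum>C\<in>Pow B. monom ((- 1) ^ card (C \<inter> J)) (card C))
           = [:1, - 1:] ^ card J * [:1, 1::real:] ^ (card B - card J)"
proof -
  have fJ: "finite J" using assms finite_subset by blast
  have "(\<Prod>b\<in>B. (if b \<in> J then [:0, - 1:] else [:0, 1::real:]) + 1)
      = (\<Sum>C\<in>Pow B. (\<Prod>b\<in>C. if b \<in> J then [:0, - 1:] else [:0, 1:]) * (\<Prod>b\<in>B - C. 1))"
    by (rule prod_add) fact
  also have "\<dots> = (\<Sum>C\<in>Pow B. monom ((- 1) ^ card (C \<inter> J)) (card C))"
  proof (rule sum.cong[OF refl])
    fix C assume "C \<in> Pow B"
    then have "finite C" using assms finite_subset by auto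
    then show "(\<Prod>b\<in>C. if b \<in> J then [:0, - 1:] else [:0, 1::real:]) * (\<Prod>b\<in>B - C. 1) = monom ((- 1) ^ card (C \<inter> J)) (card C)"
    proof (induction C)
      case (insert c C)
      then show ?case by (auto simp: Int_insert_left monom_Suc algebra_simps minus_monom)
    qed simp
  qed
  also have "(\<Prod>b\<in>B. (if b \<in> J then [:0, - 1:] else [:0, 1::real:]) + 1)
     = (\<Prod>b\<in>B. if b \<in> J then [:1, - 1:] else [:1, 1:])"
    by (intro prod.cong) (auto simp: one_pCons)
  also have "\<dots> = [:1, - 1:] ^ card J * [:1, 1::real:] ^ (card B - card J)"
    using assms fJ by (simp add: prod.If_cases Int_absorb1 Diff_eq[symmetric] card_Diff_subset)
  finally show ?thesis by simp
qed

lemma character_sum_delsarte: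
  assumes "finite B" "J \<subseteq> B" "card B = 10"
  shows "character_sum (\<lambda>C. delsarte (card C)) B J =
    (\<Sum>w\<le>10. delsarte w * coeff ([:1, - 1:] ^ card J * [:1, 1:] ^ (10 - card J)) w)"
proof -
  have "(\<Sum>w\<le>10. delsarte w * coeff ([:1, - 1:] ^ card J * [:1, 1:] ^ (10 - card J)) w)
     = (\<Sum>w\<le>10. \<Sum>C\<in>Pow B. delsarte w * coeff (monom ((- 1) ^ card (C \<inter> J)) (card C)) w)"
    unfolding sum_distrib_left[symmetric] coeff_sum[symmetric]
      signed_subset_polynomial[OF assms(1,2)] assms(3) ..
  also have "\<dots> = (\<Sum>C\<in>Pow B. \<Sum>w\<le>10. delsarte w * coeff (monom ((- 1) ^ card (C \<inter> J)) (card C)) w)"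
    by (rule sum.swap)
  also have "\<dots> = (\<Sum>C\<in>Pow B. delsarte (card C) * (- 1) ^ card (C \<inter> J))"
  proof (rule sum.cong[OF refl])
    fix C assume "C \<in> Pow B"
    then have "card C \<le> 10" using assms card_mono by fastforce
    then show "(\<Sum>w\<le>10. delsarte w * coeff (monom ((- 1) ^ card (C \<inter> J)) (card C)) w)
       = delsarte (card C) * (- 1) ^ card (C \<inter> J)"
      by (simp add: if_distrib cong: if_cong)
  qed
  finally show ?thesis by (simp add: character_sum_def)
qed

text \<open>The transform depends only on \<open>card J\<close>. It equals 128/3 at 0 and 10, 64/63 at 4 and 6, 128/63 at 5,
  and 0 at the other values.\<close>
lemma character_sum_delsarte_nonneg:
  assumes "finite B" "J \<subseteq> B" "card B = 10"
  shows "character_sum (\<lambda>C. delsarte (card C)) B J \<ge> 0"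
proof -
  have n: "{..10::nat} = {0,1,2,3,4,5,6,7,8,9,10}"
    by (simp add: eval_nat_numeral atMost_Suc insert_commute)
  have "card J \<in> {..10}" using assms card_mono by fastforce
  then show ?thesis
    unfolding character_sum_delsarte[OF assms] unfolding n
    by (auto simp: delsarte_def eval_nat_numeral)
qed

lemma sum_delsarte:
  assumes "finite B" "card B = 10"
  shows "(\<Sum>C\<in>Pow B. delsarte (card C)) = 128 / 3"
proof -
  have n: "{..10::nat} = {0,1,2,3,4,5,6,7,8,9,10}"
    by (simp add: eval_nat_numeral atMost_Suc insert_commute)
  have "(\<Sum>C\<in>Pow B. delsarte (card C)) = character_sum (\<lambda>C. delsarte (card C)) B {}"
    by (simp add: character_sum_def)
  also have "\<dots> = 128 / 3"
    unfolding character_sum_delsarte[OF assms(1) empty_subsetI assms(2)] n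
    by (simp add: delsarte_def eval_nat_numeral)
  finally show ?thesis .
qed

theorem theorem8p4:
  fixes r :: real
  assumes "r > 0"
  shows "cohn_elkies_bound TYPE(real ^ 10) r \<ge> ereal (1 / 24)
       \<and> (1 / 24 :: real) > 0.04166666"
proof
  show "(1 / 24 :: real) > 0.04166666" by simp
  show "cohn_elkies_bound TYPE(real ^ 10) r \<ge> ereal (1 / 24)"
    unfolding cohn_elkies_bound_def
  proof (rule INF_greatest)
    fix f :: "real ^ 10 \<Rightarrow> real"
    assume "f \<in> {f. cohn_elkies_admissible r f}"
    then have sm: "smooth f" and f0: "f 0 > 0" and F0: "fourier f 0 \<ge> 1"
      and neg: "\<And>x. norm x \<ge> r \<Longrightarrow> f x \<le> 0" and pos: "\<And>y. fourier f y \<ge> 0"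
      by (auto simp: cohn_elkies_admissible_def)
    define s where "s = r / 2"
    have s: "s > 0" using assms by (simp add: s_def)
    define g where "g x = f (s *\<^sub>R x)" for x
    have cf: "continuous_on UNIV f"
      using sm unfolding smooth_def by (metis times_cont_diff.simps(1))
    then have cont: "continuous_on UNIV g"
      unfolding g_def by (rule continuous_on_compose2) (auto intro!: continuous_intros)
    have Fg: "Re (fourier g y) = Re (fourier f (y /\<^sub>R s)) / s ^ 10" for y
      unfolding g_def fourier_scaleR[OF borel_measurable_continuous_onI[OF cf] s] by simp
    have F0': "Re (fourier g 0) \<ge> 1 / s ^ 10"
      using F0 s by (simp add: Fg less_eq_complex_def divide_right_mono)
    \<comment> \<open>the integral of a function that is not integrable is 0 by convention, so a nonzero value of the
      transform at 0 forces integrability\<close>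
    have int: "integrable lborel g"
    proof (rule ccontr)
      assume "\<not> integrable lborel g"
      then have "fourier g 0 = 0"
        by (simp add: fourier_def not_integrable_integral_eq)
      then show False using F0' s by simp
    qed
    have "(\<Sum>C\<in>Pow (Basis :: (real ^ 10) set). delsarte (card C)) * Re (fourier g 0)
        \<le> 2 ^ DIM(real ^ 10) * delsarte (card ({} :: (real ^ 10) set)) * g 0"
    proof (rule lattice_dual_bound[OF cont int, where h = "\<lambda>C. delsarte (card C)"])
      show "g 0 \<ge> 0" using f0 by (simp add: g_def)
      show "g x \<le> 0" if "norm x \<ge> 2" for x
        using that s neg[of "s *\<^sub>R x"] by (simp add: g_def s_def)
      show "Re (fourier g y) \<ge> 0" for y
        using pos[of "y /\<^sub>R s"] s by (simp add: Fg less_eq_complex_def)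
      fix C :: "(real ^ 10) set" assume "C \<subseteq> Basis"
      then show "character_sum (\<lambda>C. delsarte (card C)) Basis C \<ge> 0"
        by (intro character_sum_delsarte_nonneg) auto
      show "delsarte (card C) \<ge> 0" by (simp add: delsarte_def)
      have "finite C" using \<open>C \<subseteq> Basis\<close> finite_Basis finite_subset by blast
      then show "card C \<ge> 4" if "C \<noteq> {}" "delsarte (card C) \<noteq> 0"
        using that by (auto simp: delsarte_def split: if_splits)
    qed
    moreover have "(\<Sum>C\<in>Pow (Basis :: (real ^ 10) set). delsarte (card C)) = 128 / 3"
      by (rule sum_delsarte) simp_all
    moreover have "delsarte 0 = 1" by (simp add: delsarte_def)
    ultimately have "128 / 3 * Re (fourier g 0) \<le> 1024 * f 0"
      by (simp add: g_def)
    then have "128 / 3 * (1 / s ^ 10) \<le> 1024 * f 0"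
      using F0' by linarith
    then have "1 / 24 \<le> s ^ 10 * f 0" using s by (simp add: field_simps)
    then show "ereal (1 / 24) \<le> ereal ((r / 2) ^ DIM(real ^ 10) * f 0)"
      by (simp add: s_def)
  qed
qed

end
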